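(* Let $b,d\ge 1$ be integers, let $B=[n_{ij}]$ be a $b\times d$ matrix with entries $n_{ij}\in\{0,1\}$, and let $w_1,\dots,w_b$ be nonnegative integers. Consider $d$ independent drawings in each of which $b$ possible bets are available, and a gambler who wagers on bet $i$ in drawing $j$ exactly when $n_{ij}=1$ (probabilistic model in the context), so that the gambler wagers on bet $i$ in $n_i=\sum_{j} n_{ij}$ different drawings. For $i=1,\dots,b$ let $$W_i := (\text{the gambler wins bet } i \text{ at least } w_i \text{ times with bets } B),$$ and let $$I := (\text{in each drawing } j, \text{ the gambler wins at most one bet}).$$ Then $$\mathbb{P}(I\cap W_1\cap\cdots\cap W_b)\le \prod_{i=1}^b \mathbb{P}(W_i).$$
   Context: Model: for each drawing $j=1,\dots,d$ there is a random vector $\omega_j=(\omega_{1j},\dots,\omega_{bj})\in\{0,1\}^b$, where $\omega_{ij}=1$ means that bet $i$ is a winning bet in drawing $j$. The vectors $\omega_1,\dots,\omega_d$ are mutually independent, but for fixed $j$ the coordinates $\omega_{1j},\dots,\omega_{bj}$ may be arbitrarily dependent. The probability $\mathbb{P}(\omega_{ij}=1)=p_i$ is the same for all drawings $j$. The gambler wins bet $i$ in drawing $j$ if and only if $n_{ij}=1$ and $\omega_{ij}=1$. Thus $W_i$ is the event $\sum_{j=1}^d n_{ij}\omega_{ij}\ge w_i$, and $I$ is the event that $\sum_{i=1}^b n_{ij}\omega_{ij}\le 1$ for every $j=1,\dots,d$. *)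

theory Defs
  imports "HOL-Probability.Probability"
begin

text \<open>Bets are indexed by \<open>{1..b}\<close> and drawings by \<open>{1..d}\<close>. For an outcome \<open>x\<close>,
  the value \<open>\<omega> j x i\<close> is the coordinate \<open>\<omega>\<^sub>i\<^sub>j\<close> of the random vector \<open>\<omega>\<^sub>j\<close>, and \<open>n i j\<close> is
  the entry of the betting matrix \<open>B\<close> in row \<open>i\<close> and column \<open>j\<close>. All of these are 0 or 1, so
  \<open>n i j * \<omega> j x i\<close> is 1 if the gambler wins bet \<open>i\<close> in drawing \<open>j\<close> and 0 otherwise.\<close>

definition win_event ::
  "'a measure \<Rightarrow> nat \<Rightarrow> (nat \<Rightarrow> nat \<Rightarrow> nat) \<Rightarrow> (nat \<Rightarrow> nat) \<Rightarrow> (nat \<Rightarrow> 'a \<Rightarrow> nat \<Rightarrow> nat) \<Rightarrow> nat \<Rightarrow> 'a set"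
  where "win_event M d n w \<omega> i = {x \<in> space M. (\<Sum>j = 1..d. n i j * \<omega> j x i) \<ge> w i}"

definition at_most_one_win_event ::
  "'a measure \<Rightarrow> nat \<Rightarrow> nat \<Rightarrow> (nat \<Rightarrow> nat \<Rightarrow> nat) \<Rightarrow> (nat \<Rightarrow> 'a \<Rightarrow> nat \<Rightarrow> nat) \<Rightarrow> 'a set"
  where "at_most_one_win_event M b d n \<omega> =
    {x \<in> space M. \<forall>j \<in> {1..d}. (\<Sum>i = 1..b. n i j * \<omega> j x i) \<le> 1}"

text \<open>The library's \<open>indep_vars\<close> includes measurability, so each \<open>\<omega>\<^sub>j\<close> is a random vector with
  values in \<open>{0,1}\<^sup>b\<close>, realised as the finite product of \<open>count_space {0, 1}\<close> over the index set
  \<open>{1..b}\<close>. Points of that product are undefined outside \<open>{1..b}\<close>, whence the \<open>restrict\<close>.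
  Nothing is required of the joint distribution of the coordinates of a single \<open>\<omega>\<^sub>j\<close>.\<close>

definition drawing_model ::
  "'a measure \<Rightarrow> nat \<Rightarrow> nat \<Rightarrow> (nat \<Rightarrow> real) \<Rightarrow> (nat \<Rightarrow> 'a \<Rightarrow> nat \<Rightarrow> nat) \<Rightarrow> bool"
  where "drawing_model M b d p \<omega> \<longleftrightarrow>
    prob_space M \<and>
    prob_space.indep_vars M (\<lambda>j. \<Pi>\<^sub>M i\<in>{1..b}. count_space {0, 1 :: nat})
      (\<lambda>j x. restrict (\<omega> j x) {1..b}) {1..d} \<and>
    (\<forall>i \<in> {1..b}. \<forall>j \<in> {1..d}. measure M {x \<in> space M. \<omega> j x i = 1} = p i)"

end

theory Submission imports Defs begin

text \<open>Induct on the number of drawings. Let \<open>h\<^sub>i(v)\<close> be the probability that bet \<open>i\<close> wins at least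
  \<open>v\<close> of the earlier drawings, put \<open>\<delta>\<^sub>i = h\<^sub>i(w\<^sub>i - 1) - h\<^sub>i(w\<^sub>i) \<ge> 0\<close>, and let \<open>q\<^sub>i\<close> be the probability
  that in the last drawing \<open>i\<close> is the only winning bet. These events are disjoint, so \<open>\<Sum> q\<^sub>i \<le> 1\<close>,
  and conditioning the left-hand side on the last drawing bounds it by
  \<open>\<Prod> h\<^sub>i(w\<^sub>i) + (\<Sum>i. q\<^sub>i \<delta>\<^sub>i \<Prod>k \<noteq> i. h\<^sub>k(w\<^sub>k))\<close>. These are the terms of degree at most one in the \<open>\<delta>\<^sub>i\<close>
  of \<open>\<Prod> (h\<^sub>i(w\<^sub>i) + q\<^sub>i \<delta>\<^sub>i)\<close>, and each factor of that product is at most the probability that bet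
  \<open>i\<close> wins at least \<open>w\<^sub>i\<close> times in all drawings.\<close>

text \<open>Multiplying out the right-hand product gives the left-hand side as its terms of degree
  at most one in \<open>x\<close>; the remaining terms are nonnegative. The induction splits off the
  factor \<open>a m + x m\<close> and discards these terms by enlarging
  \<open>x m * (\<Prod>i\<in>I. a i)\<close>.\<close>

lemma prod_plus_sum_le_prod_add:
  fixes a x :: "'i \<Rightarrow> real"
  assumes "finite I" "\<And>i. i \<in> I \<Longrightarrow> 0 \<le> a i" "\<And>i. i \<in> I \<Longrightarrow> 0 \<le> x i"
  shows "(\<Prod>i\<in>I. a i) + (\<Sum>i\<in>I. x i * (\<Prod>k\<in>I - {i}. a k)) \<le> (\<Prod>i\<in>I. a i + x i)"
  using assms
proof (induction I rule: finite_induct)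
  case empty
  then show ?case by simp
next
  case (insert m I)
  have eq: "(\<Prod>k\<in>insert m I - {i}. a k) = a m * (\<Prod>k\<in>I - {i}. a k)" if "i \<in> I" for i
  proof -
    have "insert m I - {i} = insert m (I - {i})" using that insert.hyps by auto
    then show ?thesis using insert.hyps by simp
  qed
  have "(\<Prod>i\<in>insert m I. a i) + (\<Sum>i\<in>insert m I. x i * (\<Prod>k\<in>insert m I - {i}. a k))
      = a m * ((\<Prod>i\<in>I. a i) + (\<Sum>i\<in>I. x i * (\<Prod>k\<in>I - {i}. a k))) + x m * (\<Prod>i\<in>I. a i)"
    using insert.hyps by (simp add: eq sum_distrib_left algebra_simps cong: sum.cong)
  also have "\<dots> \<le> a m * (\<Prod>i\<in>I. a i + x i) + x m * (\<Prod>i\<in>I. a i + x i)"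
    using insert.prems insert.IH
    by (intro add_mono mult_left_mono prod_mono) auto
  also have "\<dots> = (\<Prod>i\<in>insert m I. a i + x i)"
    using insert.hyps by (simp add: algebra_simps)
  finally show ?case .
qed

text \<open>This is the tool for conditioning on the last drawing \<open>j\<close>: the block of
  variables over \<open>J\<close> is independent of the block over \<open>{j}\<close>, hence so are
  the truth values of \<open>P\<close> and \<open>Q\<close>. Since the second block is a one-element
  product, \<open>Q\<close> is read through its coordinate \<open>j\<close>.\<close>

lemma (in prob_space) indep_vars_prob_insert:
  assumes ind: "indep_vars N X (insert j J)" and "j \<notin> J"
    and P: "Measurable.pred (PiM J N) P" and Q: "Measurable.pred (N j) Q"
  shows "prob {x \<in> space M. P (\<lambda>k\<in>J. X k x) \<and> Q (X j x)}
    = prob {x \<in> space M. P (\<lambda>k\<in>J. X k x)} * prob {x \<in> space M. Q (X j x)}"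
proof -
  have ind2: "indep_var (PiM J N) (\<lambda>x. \<lambda>k\<in>J. X k x) (PiM {j} N) (\<lambda>x. \<lambda>k\<in>{j}. X k x)"
    by (rule indep_var_restrict[OF ind]) (use \<open>j \<notin> J\<close> in auto)
  have Q': "Measurable.pred (PiM {j} N) (\<lambda>f. Q (f j))"
    using Q by (intro measurable_compose[where g = Q, OF measurable_component_singleton]) auto
  have "indep_var (count_space UNIV) (P \<circ> (\<lambda>x. \<lambda>k\<in>J. X k x))
      (count_space UNIV) ((\<lambda>f. Q (f j)) \<circ> (\<lambda>x. \<lambda>k\<in>{j}. X k x))"
    by (rule indep_var_compose[OF ind2 P Q'])
  from indep_varD[OF this, of "{True}" "{True}"] show ?thesis
    by (simp add: vimage_def Int_def conj_commute cong: conj_cong)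
qed

text \<open>Coordinates arrive as \<open>count_space\<close> valued maps, whereas their sums are
  treated as Borel functions; the two sigma-algebras on the naturals agree.\<close>

lemma measurable_borel_nat: "measurable A (borel :: nat measure) = measurable A (count_space UNIV)"
  by (rule measurable_cong_sets) (simp_all add: sets_borel_eq_count_space)

text \<open>The form suits induction on the drawings: \<open>X j x i\<close> is what drawing
  \<open>j\<close> adds to the count of bet \<open>i\<close>, with the betting matrix absorbed. The
  thresholds \<open>w\<close> stay general because the induction hypothesis is applied both at
  \<open>w\<close> and with a single threshold lowered.\<close>

theorem (in prob_space) prob_exclusive_counts_le:
  fixes X :: "'j \<Rightarrow> 'a \<Rightarrow> 'i \<Rightarrow> nat"
  assumes "finite J" "finite I"
    and "indep_vars (\<lambda>_. \<Pi>\<^sub>M i\<in>I. count_space UNIV) X J"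
  shows "prob {x \<in> space M. (\<forall>j\<in>J. (\<Sum>i\<in>I. X j x i) \<le> 1) \<and> (\<forall>i\<in>I. w i \<le> (\<Sum>j\<in>J. X j x i))}
    \<le> (\<Prod>i\<in>I. prob {x \<in> space M. w i \<le> (\<Sum>j\<in>J. X j x i)})"
  using assms(1,3)
proof (induction J arbitrary: w rule: finite_induct)
  case empty
  show ?case
  \<comment> \<open>Without drawings all counts are 0, so the left-hand event is certain if every
    threshold vanishes and empty otherwise.\<close>
  proof (cases "\<forall>i\<in>I. w i = 0")
    case True
    then show ?thesis by (simp add: prob_space)
  next
    case False
    then have "prob {x \<in> space M. \<forall>i\<in>I. w i = 0} = 0"
      by (subst measure_empty[of M, symmetric], intro arg_cong[where f = prob]) auto
    then show ?thesis by (simp add: prod_nonneg)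
  qed
next
  case (insert j J)
  let ?N = "\<Pi>\<^sub>M i\<in>I. count_space (UNIV :: nat set)"
  note ind = insert.prems
  have IH: "prob {x \<in> space M. (\<forall>j\<in>J. (\<Sum>i\<in>I. X j x i) \<le> 1) \<and> (\<forall>i\<in>I. v i \<le> (\<Sum>j\<in>J. X j x i))}
    \<le> (\<Prod>i\<in>I. prob {x \<in> space M. v i \<le> (\<Sum>j\<in>J. X j x i)})" for v
    by (rule insert.IH) (rule indep_vars_subset[OF ind], auto)
  have rv: "random_variable ?N (X k)" if "k \<in> insert j J" for k
    using ind that unfolding indep_vars_def by auto
  have cm: "(\<lambda>x. X k x i) \<in> borel_measurable M" if "k \<in> insert j J" "i \<in> I" for k i
    unfolding measurable_borel_nat
    by (rule measurable_compose[where g = "\<lambda>f. f i", OF rv]) (use that in auto)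
  have cmJ[measurable]: "k \<in> J \<Longrightarrow> i \<in> I \<Longrightarrow> (\<lambda>x. X k x i) \<in> borel_measurable M" for k i
    by (rule cm) auto
  have cmj[measurable]: "i \<in> I \<Longrightarrow> (\<lambda>x. X j x i) \<in> borel_measurable M" for i
    by (rule cm) auto
  have cf[measurable]: "i \<in> I \<Longrightarrow> (\<lambda>f. f i) \<in> borel_measurable ?N" for i
    unfolding measurable_borel_nat by auto
  have cN[measurable]: "k \<in> J \<Longrightarrow> i \<in> I \<Longrightarrow> (\<lambda>g. g k i) \<in> borel_measurable (PiM J (\<lambda>_. ?N))" for k i
    unfolding measurable_borel_nat
    by (rule measurable_compose[where g = "\<lambda>f. f i", OF measurable_component_singleton]) auto
  note [measurable] = \<open>finite I\<close> \<open>finite J\<close>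

  define L where "L v x \<longleftrightarrow> (\<forall>j\<in>J. (\<Sum>i\<in>I. X j x i) \<le> 1) \<and> (\<forall>i\<in>I. v i \<le> (\<Sum>j\<in>J. X j x i))" for v x
  define h where "h v i = prob {x \<in> space M. v \<le> (\<Sum>j\<in>J. X j x i)}" for v i
  \<comment> \<open>For \<open>i\<close> in \<open>I\<close> the two bounds together force
    coordinate \<open>i\<close> to be 1 and all other coordinates in \<open>I\<close> to be 0: bet
    \<open>i\<close> is the only winner.\<close>
  define U where "U i f \<longleftrightarrow> 1 \<le> f i \<and> (\<Sum>i\<in>I. f i) \<le> 1" for i and f :: "'i \<Rightarrow> nat"
  define q where "q i = prob {x \<in> space M. U i (X j x)}" for i
  have Lm[measurable]: "Measurable.pred M (L v)" for v
    unfolding L_def by measurable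
  have Um: "Measurable.pred ?N (U i)" if "i \<in> I" for i
    unfolding U_def using that by measurable
  have UXm[measurable]: "Measurable.pred M (\<lambda>x. U i (X j x))" if "i \<in> I" for i
    by (rule measurable_compose[OF rv Um]) (use that in auto)
  have split: "prob {x \<in> space M. L v x \<and> Q (X j x)}
      = prob {x \<in> space M. L v x} * prob {x \<in> space M. Q (X j x)}"
    if Q: "Measurable.pred ?N Q" for v Q
  proof -
    let ?P = "\<lambda>g. (\<forall>k\<in>J. (\<Sum>i\<in>I. g k i) \<le> 1) \<and> (\<forall>i\<in>I. v i \<le> (\<Sum>k\<in>J. g k i))"
    have "Measurable.pred (PiM J (\<lambda>_. ?N)) ?P"
      by measurable
    from indep_vars_prob_insert[OF ind \<open>j \<notin> J\<close> this Q] show ?thesis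
      by (simp add: L_def)
  qed
  have hsplit: "prob {x \<in> space M. v \<le> (\<Sum>j\<in>J. X j x i) \<and> Q (X j x)}
      = h v i * prob {x \<in> space M. Q (X j x)}"
    if Q: "Measurable.pred ?N Q" and i: "i \<in> I" for v Q i
  proof -
    have "Measurable.pred (PiM J (\<lambda>_. ?N)) (\<lambda>g. v \<le> (\<Sum>k\<in>J. g k i))"
      using i by measurable
    from indep_vars_prob_insert[OF ind \<open>j \<notin> J\<close> this Q] show ?thesis
      by (simp add: h_def)
  qed

  \<comment> \<open>As the complement of all \<open>U i\<close>, this covers several wins as well as
    none, so its probability is exactly one minus the sum of the \<open>q i\<close>. Inside
    \<open>?S\<close> only the case of no win remains.\<close>
  define U0 where "U0 f \<longleftrightarrow> \<not> (\<exists>i\<in>I. U i f)" for f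
  have U0m: "Measurable.pred ?N U0"
    unfolding U0_def using Um \<open>finite I\<close> by measurable
  have U0Xm: "Measurable.pred M (\<lambda>x. U0 (X j x))"
    by (rule measurable_compose[OF rv U0m]) auto
  have disj: "i = i'" if "U i f" "U i' f" "i \<in> I" "i' \<in> I" for i i' f
  proof (rule ccontr)
    assume "i \<noteq> i'"
    then have "f i + f i' = sum f {i, i'}" by simp
    also have "\<dots> \<le> sum f I" using that \<open>finite I\<close> by (intro sum_mono2) auto
    finally show False using that by (auto simp: U_def)
  qed
  have q0: "prob {x \<in> space M. U0 (X j x)} = 1 - (\<Sum>i\<in>I. q i)"
  proof -
    have "(\<Sum>i\<in>I. q i) = prob (\<Union>i\<in>I. {x \<in> space M. U i (X j x)})"
      unfolding q_def using \<open>finite I\<close>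
      by (intro finite_measure_finite_Union[symmetric]) (auto simp: disjoint_family_on_def dest: disj)
    also have "(\<Union>i\<in>I. {x \<in> space M. U i (X j x)}) = space M - {x \<in> space M. U0 (X j x)}"
      by (auto simp: U0_def)
    also have "prob \<dots> = 1 - prob {x \<in> space M. U0 (X j x)}"
      using U0Xm by (intro prob_compl) simp
    finally show ?thesis by simp
  qed
  have q0': "(\<Sum>i\<in>I. q i) \<le> 1" using q0 measure_nonneg[of M "{x \<in> space M. U0 (X j x)}"] by linarith

  \<comment> \<open>The subtraction is truncated: if \<open>w i = 0\<close>, then
    \<open>?w i\<close> is \<open>w\<close> itself and the difference
    \<open>h (w i - 1) i - h (w i) i\<close> is 0.\<close>
  let ?w = "\<lambda>i. w(i := w i - 1)"
  let ?S = "{x \<in> space M. (\<forall>j\<in>insert j J. (\<Sum>i\<in>I. X j x i) \<le> 1) \<and> (\<forall>i\<in>I. w i \<le> (\<Sum>j\<in>insert j J. X j x i))}"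
  \<comment> \<open>If the last drawing has no win, the earlier ones already reach \<open>w\<close>;
    if its only win is on bet \<open>i\<close>, they may fall short by one, at \<open>i\<close>
    alone.\<close>
  have sub: "?S \<subseteq> {x \<in> space M. L w x \<and> U0 (X j x)} \<union> (\<Union>i\<in>I. {x \<in> space M. L (?w i) x \<and> U i (X j x)})"
  proof
    fix x assume x: "x \<in> ?S"
    then have s: "(\<Sum>i\<in>I. X j x i) \<le> 1" by simp
    have wle: "w i \<le> X j x i + (\<Sum>j\<in>J. X j x i)" if "i \<in> I" for i
      using x insert.hyps that by auto
    show "x \<in> {x \<in> space M. L w x \<and> U0 (X j x)} \<union> (\<Union>i\<in>I. {x \<in> space M. L (?w i) x \<and> U i (X j x)})"
    proof (cases "\<exists>i\<in>I. U i (X j x)")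
      case True
      then obtain i where i: "i \<in> I" "U i (X j x)" by blast
      have one: "X j x i \<le> 1"
        using member_le_sum[OF i(1), of "X j x"] s \<open>finite I\<close> by auto
      have zero: "X j x k = 0" if "k \<in> I" "k \<noteq> i" for k
        using disj[of k "X j x" i] that i s by (fastforce simp: U_def)
      have "?w i k \<le> (\<Sum>j\<in>J. X j x k)" if "k \<in> I" for k
        using wle[OF that] zero[OF that] one by (cases "k = i") auto
      then have "L (?w i) x" using x by (auto simp: L_def)
      then show ?thesis using i x by auto
    next
      case False
      then have "X j x k = 0" if "k \<in> I" for k
        using that s by (fastforce simp: U_def)
      then have "L w x" using x wle by (auto simp: L_def)
      then show ?thesis using False x by (auto simp: U0_def)
    qed
  qed
  have hmono: "h v i \<le> h (v - 1) i" if "i \<in> I" for v i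
    unfolding h_def using insert.hyps that by (intro finite_measure_mono) (auto, measurable)
  have qnn: "0 \<le> q i" for i by (simp add: q_def)
  have hnn: "0 \<le> h v i" for v i by (simp add: h_def)

  have E0: "{x \<in> space M. L w x \<and> U0 (X j x)} \<in> events"
    using U0Xm by measurable
  have E: "{x \<in> space M. L (?w i) x \<and> U i (X j x)} \<in> events" if "i \<in> I" for i
    using that by measurable

  have "prob ?S \<le> prob ({x \<in> space M. L w x \<and> U0 (X j x)} \<union> (\<Union>i\<in>I. {x \<in> space M. L (?w i) x \<and> U i (X j x)}))"
    using sub E0 E \<open>finite I\<close> by (intro finite_measure_mono sets.Un sets.finite_UN) auto
  also have "\<dots> \<le> prob {x \<in> space M. L w x \<and> U0 (X j x)} + prob (\<Union>i\<in>I. {x \<in> space M. L (?w i) x \<and> U i (X j x)})"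
    using E0 E \<open>finite I\<close> by (intro measure_Un_le sets.finite_UN) auto
  also have "\<dots> \<le> prob {x \<in> space M. L w x \<and> U0 (X j x)} + (\<Sum>i\<in>I. prob {x \<in> space M. L (?w i) x \<and> U i (X j x)})"
    using E \<open>finite I\<close> by (intro add_left_mono measure_UNION_le) auto
  \<comment> \<open>Independence of the last drawing from the earlier ones factors every
    term.\<close>
  also have "\<dots> = (1 - (\<Sum>i\<in>I. q i)) * prob {x \<in> space M. L w x} + (\<Sum>i\<in>I. q i * prob {x \<in> space M. L (?w i) x})"
    using split[OF U0m] split[OF Um] q0 by (simp add: q_def mult.commute)
  \<comment> \<open>The induction hypothesis enters at \<open>w\<close> and at each
    \<open>?w i\<close>; the first coefficient is nonnegative by \<open>q0'\<close>.\<close>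
  also have "\<dots> \<le> (1 - (\<Sum>i\<in>I. q i)) * (\<Prod>k\<in>I. h (w k) k) + (\<Sum>i\<in>I. q i * (\<Prod>k\<in>I. h (?w i k) k))"
    using IH q0' qnn unfolding L_def h_def by (intro add_mono mult_left_mono sum_mono) auto
  \<comment> \<open>The product for \<open>?w i\<close> differs from the one for \<open>w\<close>
    only in factor \<open>i\<close>, so distributing the subtracted \<open>q i\<close> over the sum
    leaves the differences of the \<open>h\<close> values.\<close>
  also have "\<dots> = (\<Prod>k\<in>I. h (w k) k) + (\<Sum>i\<in>I. q i * (h (w i - 1) i - h (w i) i) * (\<Prod>k\<in>I - {i}. h (w k) k))"
  proof -
    have a: "(\<Prod>k\<in>I. h (?w i k) k) = h (w i - 1) i * (\<Prod>k\<in>I - {i}. h (w k) k)"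
      and b: "(\<Prod>k\<in>I. h (w k) k) = h (w i) i * (\<Prod>k\<in>I - {i}. h (w k) k)" if "i \<in> I" for i
      using \<open>finite I\<close> that by (auto simp: prod.remove intro!: prod.cong)
    have "q i * (h (w i - 1) i - h (w i) i) * (\<Prod>k\<in>I - {i}. h (w k) k)
        = q i * (\<Prod>k\<in>I. h (?w i k) k) - q i * (\<Prod>k\<in>I. h (w k) k)" if "i \<in> I" for i
      unfolding a[OF that] b[OF that] by (simp add: algebra_simps)
    then have "(\<Sum>i\<in>I. q i * (h (w i - 1) i - h (w i) i) * (\<Prod>k\<in>I - {i}. h (w k) k))
        = (\<Sum>i\<in>I. q i * (\<Prod>k\<in>I. h (?w i k) k)) - (\<Sum>i\<in>I. q i) * (\<Prod>k\<in>I. h (w k) k)"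
      by (simp add: sum_subtractf sum_distrib_right)
    then show ?thesis by (simp add: algebra_simps)
  qed
  also have "\<dots> \<le> (\<Prod>i\<in>I. h (w i) i + q i * (h (w i - 1) i - h (w i) i))"
    using hnn qnn hmono \<open>finite I\<close> by (intro prod_plus_sum_le_prod_add) auto
  also have "\<dots> \<le> (\<Prod>i\<in>I. prob {x \<in> space M. w i \<le> (\<Sum>j\<in>insert j J. X j x i)})"
  proof (intro prod_mono conjI)
    fix i assume i: "i \<in> I"
    show "0 \<le> h (w i) i + q i * (h (w i - 1) i - h (w i) i)"
      using hnn qnn hmono[OF i] by simp
    have nUm: "Measurable.pred ?N (\<lambda>f. \<not> U i f)" using Um[OF i] by measurable
    \<comment> \<open>The factor is the mixture of \<open>h (w i - 1) i\<close> and
      \<open>h (w i) i\<close> with weights \<open>q i\<close> and \<open>1 - q i\<close>. If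
      \<open>i\<close> is the sole winner of the last drawing, one earlier win fewer suffices;
      otherwise any win on \<open>i\<close> in that drawing is ignored, which only lowers the
      probability.\<close>
    let ?A = "{x \<in> space M. w i - 1 \<le> (\<Sum>j\<in>J. X j x i) \<and> U i (X j x)}"
    let ?B = "{x \<in> space M. w i \<le> (\<Sum>j\<in>J. X j x i) \<and> \<not> U i (X j x)}"
    have AB: "?A \<in> events" "?B \<in> events" using i by measurable
    have "prob {x \<in> space M. \<not> U i (X j x)} = 1 - q i"
      unfolding q_def using i by (intro prob_neg) measurable
    then have "prob ?A + prob ?B = h (w i - 1) i * q i + h (w i) i * (1 - q i)"
      by (simp only: hsplit[OF Um[OF i] i] hsplit[OF nUm i] q_def)
    then have "h (w i) i + q i * (h (w i - 1) i - h (w i) i) = prob ?A + prob ?B"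
      by (simp add: algebra_simps)
    also have "\<dots> = prob (?A \<union> ?B)"
      using AB by (intro finite_measure_Union[symmetric]) auto
    also have "\<dots> \<le> prob {x \<in> space M. w i \<le> (\<Sum>j\<in>insert j J. X j x i)}"
    proof (rule finite_measure_mono)
      show "?A \<union> ?B \<subseteq> {x \<in> space M. w i \<le> (\<Sum>j\<in>insert j J. X j x i)}"
        using insert.hyps by (auto simp: U_def)
      show "{x \<in> space M. w i \<le> (\<Sum>j\<in>insert j J. X j x i)} \<in> events"
        unfolding sum.insert[OF insert.hyps(1,2)] using i by measurable
    qed
    finally show "h (w i) i + q i * (h (w i - 1) i - h (w i) i)
      \<le> prob {x \<in> space M. w i \<le> (\<Sum>j\<in>insert j J. X j x i)}" .
  qed
  finally show ?case .
qed

theorem proposition5p1: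
  fixes M :: "'a measure"
    and b d :: nat
    and n :: "nat \<Rightarrow> nat \<Rightarrow> nat"
    and w :: "nat \<Rightarrow> nat"
    and p :: "nat \<Rightarrow> real"
    and \<omega> :: "nat \<Rightarrow> 'a \<Rightarrow> nat \<Rightarrow> nat"
  assumes "b \<ge> 1" and "d \<ge> 1"
    and "\<And>i j. i \<in> {1..b} \<Longrightarrow> j \<in> {1..d} \<Longrightarrow> n i j \<in> {0, 1}"
    and "drawing_model M b d p \<omega>"
  shows "measure M (at_most_one_win_event M b d n \<omega> \<inter> (\<Inter>i \<in> {1..b}. win_event M d n w \<omega> i))
           \<le> (\<Prod>i = 1..b. measure M (win_event M d n w \<omega> i))"
proof -
  interpret prob_space M using assms(4) by (simp add: drawing_model_def)
  \<comment> \<open>Multiplying by column \<open>j\<close> of the betting matrix is a measurable map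
    of the \<open>j\<close>-th random vector alone, so independence across drawings survives. The
    restriction to \<open>{1..b}\<close> is invisible to sums over that range.\<close>
  let ?Y = "\<lambda>j f. \<lambda>i\<in>{1..b}. n i j * f i"
  have "indep_vars (\<lambda>j. \<Pi>\<^sub>M i\<in>{1..b}. count_space {0, 1 :: nat})
      (\<lambda>j x. restrict (\<omega> j x) {1..b}) {1..d}"
    using assms(4) by (simp add: drawing_model_def)
  moreover have "?Y j \<in> measurable (\<Pi>\<^sub>M i\<in>{1..b}. count_space {0, 1 :: nat})
      (\<Pi>\<^sub>M i\<in>{1..b}. count_space UNIV)" for j
    by (intro measurable_restrict measurable_compose[OF measurable_component_singleton]) auto
  ultimately have "indep_vars (\<lambda>_. \<Pi>\<^sub>M i\<in>{1..b}. count_space UNIV)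
      (\<lambda>j x. ?Y j (restrict (\<omega> j x) {1..b})) {1..d}"
    by (rule indep_vars_compose2[where Y = ?Y])
  from prob_exclusive_counts_le[OF _ _ this, of w]
  have "prob {x \<in> space M. (\<forall>j\<in>{1..d}. (\<Sum>i = 1..b. n i j * \<omega> j x i) \<le> 1) \<and>
      (\<forall>i\<in>{1..b}. w i \<le> (\<Sum>j = 1..d. n i j * \<omega> j x i))}
    \<le> (\<Prod>i = 1..b. prob {x \<in> space M. w i \<le> (\<Sum>j = 1..d. n i j * \<omega> j x i)})"
    by simp
  moreover have "at_most_one_win_event M b d n \<omega> \<inter> (\<Inter>i \<in> {1..b}. win_event M d n w \<omega> i)
    = {x \<in> space M. (\<forall>j\<in>{1..d}. (\<Sum>i = 1..b. n i j * \<omega> j x i) \<le> 1) \<and>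
      (\<forall>i\<in>{1..b}. w i \<le> (\<Sum>j = 1..d. n i j * \<omega> j x i))}"
    by (auto simp: at_most_one_win_event_def win_event_def)
  ultimately show ?thesis by (simp add: win_event_def)
qed

end
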